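(* For every $\epsilon>0$ there exists $x_0$ such that for all $x>x_0$ the following holds. Let $A\subseteq[1,x]\cap\mathbb{N}$ be a set of integers such that $A+A$ contains no squarefree integer. If $|A|>(\frac{1}{18}+\epsilon)x$, then $A$ is a subset of $4\mathbb{N}$, of $9\mathbb{N}$, or of $4\mathbb{N}+2$.
   Context: $A+A=\{a+b: a,b\in A\}$. For a positive integer $m$ and an integer $r$, $m\mathbb{N}+r$ denotes the set of positive integers congruent to $r$ modulo $m$ (so $4\mathbb{N}$ is the set of positive multiples of $4$, and $4\mathbb{N}+2$ the set of positive integers $\equiv 2 \pmod 4$). *)

theory Defs
  imports "HOL-Computational_Algebra.Squarefree" Complex_Main
begin

end

theory Submission
  imports Defs "HOL-Computational_Algebra.Primes"
begin

text \<open>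
  Split \<open>A\<close> into cells by residues modulo \<open>4\<close>, \<open>9\<close> and \<open>25\<close>. If a cell \<open>t\<close> and some \<open>a\<close> in \<open>A\<close> have no
  sum divisible by \<open>4\<close>, \<open>9\<close> or \<open>25\<close>, then each \<open>n\<close> in the cell has \<open>n + a\<close> divisible by the square
  of a prime \<open>p \<ge> 7\<close>; as the sum of \<open>1 / p\<^sup>2\<close> over these primes is below \<open>w = 53 / 1000\<close>, the cell holds
  at most \<open>w x / 900\<close> elements up to \<open>O(sqrt x)\<close>. Any other cell holds at most \<open>x / 900 + 1\<close>. It remains
  to see that the occupied cells, weighted by \<open>1\<close> or \<open>w\<close>, have total weight at most \<open>50 = 900 / 18\<close>
  unless \<open>A\<close> is special. Group the cells into 36 fibres by the residues modulo \<open>4\<close> and \<open>9\<close>, and call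
  a fibre isolated if its sum with every occupied fibre vanishes modulo \<open>4\<close> or modulo \<open>9\<close>. A fibre that is
  not isolated weighs at most \<open>1 + 24 w \<le> 25 / 11\<close>. With two isolated fibres, \<open>A\<close> is special or occupies
  only two fibres; with exactly one, \<open>A\<close> occupies at most 12 fibres, of total weight at most
  \<open>25 + 11 \<cdot> 25 / 11 = 50\<close>.
\<close>

section \<open>The sum of inverse squares of primes from 7 on\<close>

text \<open>The two terms for \<open>k\<close> add up to about \<open>1 / (18 * k\<^sup>2)\<close>.
  The majorant \<open>2 / (9 * (4 * k\<^sup>2 - 1))\<close> has the same leading term and
  telescopes.\<close>

lemma sum_inverse_squares_coprime_6:
  fixes K M :: nat
  assumes "K \<ge> 1"
  shows "(\<Sum>k=K..<K+M. 1 / (6 * real k - 1)\<^sup>2 + 1 / (6 * real k + 1)\<^sup>2)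
           \<le> 1 / (18 * real K - 9) - 1 / (18 * real (K + M) - 9)"
proof (induction M)
  case (Suc M)
  define k where "k = real (K + M)"
  have k: "k \<ge> 1" using assms by (simp add: k_def)
  have "k * k \<ge> 1 * 1" using k by (intro mult_mono) auto
  then have k2: "k\<^sup>2 \<ge> 1" by (simp add: power2_eq_square)
  have pos: "(36 * k\<^sup>2 - 1)\<^sup>2 > 0" "9 * (4 * k\<^sup>2 - 1) > 0" using k2 by auto
  have "1 / (6 * k - 1)\<^sup>2 + 1 / (6 * k + 1)\<^sup>2 = ((6*k+1)\<^sup>2 + (6*k-1)\<^sup>2) / ((6*k-1)\<^sup>2 * (6*k+1)\<^sup>2)"
    using k by (simp add: divide_simps)
  also have "\<dots> = (72 * k\<^sup>2 + 2) / (36 * k\<^sup>2 - 1)\<^sup>2"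
    by (simp add: power2_eq_square algebra_simps)
  also have "\<dots> \<le> 2 / (9 * (4 * k\<^sup>2 - 1))"
  proof -
    have "2 * (36 * k\<^sup>2 - 1)\<^sup>2 - (72 * k\<^sup>2 + 2) * (9 * (4 * k\<^sup>2 - 1)) = 432 * k\<^sup>2 + 20"
      by (simp add: power2_eq_square algebra_simps)
    moreover have "432 * k\<^sup>2 + 20 \<ge> 0" using k2 by auto
    ultimately show ?thesis using pos by (simp add: divide_le_eq le_divide_eq mult.commute)
  qed
  also have "\<dots> = 1 / (18 * k - 9) - 1 / (18 * (k + 1) - 9)"
  proof -
    have "18 * k - 9 \<noteq> 0" "18 * (k + 1) - 9 \<noteq> 0" "9 * (4 * k\<^sup>2 - 1) \<noteq> 0" using k pos by auto
    then show ?thesis by (simp add: divide_simps) (simp add: power2_eq_square algebra_simps)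
  qed
  finally show ?case using Suc by (simp add: k_def algebra_simps)
qed simp

text \<open>The primes up to 83 are summed explicitly and the rest is at most
  \<open>1 / (18 * 15 - 9) = 1 / 261\<close>. Little room is left: the weight argument needs
  \<open>1 + 24 * w \<le> 25 / 11\<close>, that is,
  \<open>w \<le> 7 / 132 = 0.05303...\<close>.\<close>

lemma sum_inverse_prime_squares:
  fixes T :: "nat set"
  assumes "finite T" "\<And>p. p \<in> T \<Longrightarrow> prime p \<and> p \<ge> 7"
  shows "(\<Sum>p\<in>T. 1 / (real p)\<^sup>2) \<le> 53 / 1000"
proof -
  define L :: "nat set" where "L = {7,11,13,17,19,23,29,31,37,41,43,47,53,59,61,67,71,73,79,83}"
  obtain N where N: "\<And>p. p \<in> T \<Longrightarrow> p \<le> N" using assms(1) finite_nat_set_iff_bounded_le by auto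
  define f where "f k = {6 * k - 1, 6 * k + 1}" for k :: nat
  \<comment> \<open>The primes from \<open>89\<close> on are bounded by all numbers \<open>6 k - 1\<close> and \<open>6 k + 1\<close> with \<open>k \<ge> 15\<close>.\<close>
  have T: "T \<subseteq> L \<union> (\<Union>k\<in>{15..<15+N}. f k)"
  proof
    fix p assume p: "p \<in> T"
    then have pr: "prime p" "p \<ge> 7" using assms by auto
    have dv: "d = 1 \<or> d = p" if "d dvd p" for d
      using pr(1) that unfolding prime_nat_iff by blast
    have nd: "\<not> d dvd p" if "d \<in> {2,3,5}" for d
      using dv[of d] pr(2) that by auto
    have nd7: "7 dvd p \<Longrightarrow> p = 7" using dv[of 7] by simp
    show "p \<in> L \<union> (\<Union>k\<in>{15..<15+N}. f k)"
    proof (cases "p < 89")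
      case True
      \<comment> \<open>Sieving by 2, 3, 5 and 7 leaves only primes here, because
        \<open>89 < 11 * 11\<close>.\<close>
      have "\<forall>p\<in>set [7..<89]. \<not> 2 dvd p \<and> \<not> 3 dvd p \<and> \<not> 5 dvd p \<and> (7 dvd p \<longrightarrow> p = 7) \<longrightarrow> p \<in> L"
        by (simp add: L_def)
      moreover have "p \<in> set [7..<89]" unfolding set_upt using True pr(2) by simp
      ultimately have "p \<in> L" using nd nd7 by blast
      then show ?thesis by simp
    next
      case False
      have "\<not> 2 dvd p" "\<not> 3 dvd p" using nd by auto
      then have "p = 6 * ((p + 1) div 6) - 1 \<or> p = 6 * ((p + 1) div 6) + 1" by presburger
      then have "p \<in> f ((p + 1) div 6)" by (simp add: f_def)
      moreover have "(p + 1) div 6 \<in> {15..<15+N}" using False N[OF p] by auto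
      ultimately show ?thesis by blast
    qed
  qed
  have "(\<Sum>p\<in>T. 1 / (real p)\<^sup>2) \<le> (\<Sum>p\<in>L \<union> (\<Union>k\<in>{15..<15+N}. f k). 1 / (real p)\<^sup>2)"
    using T by (intro sum_mono2) (auto simp: L_def f_def)
  also have "\<dots> \<le> (\<Sum>p\<in>L. 1 / (real p)\<^sup>2) + (\<Sum>p\<in>(\<Union>k\<in>{15..<15+N}. f k). 1 / (real p)\<^sup>2)"
    by (subst sum.union_inter[symmetric]) (auto simp: L_def f_def intro!: sum_nonneg)
  also have "(\<Sum>p\<in>(\<Union>k\<in>{15..<15+N}. f k). 1 / (real p)\<^sup>2) = (\<Sum>k=15..<15+N. \<Sum>p\<in>f k. 1 / (real p)\<^sup>2)"
    by (rule sum.UNION_disjoint) (auto simp: f_def; presburger)+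
  also have "\<dots> = (\<Sum>k=15..<15+N. 1 / (6 * real k - 1)\<^sup>2 + 1 / (6 * real k + 1)\<^sup>2)"
  proof (rule sum.cong)
    fix k assume "k \<in> {15..<15+N}"
    then have "6 * k - 1 \<noteq> 6 * k + 1" "real (6 * k - 1) = 6 * real k - 1" by auto
    then show "(\<Sum>p\<in>f k. 1 / (real p)\<^sup>2) = 1 / (6 * real k - 1)\<^sup>2 + 1 / (6 * real k + 1)\<^sup>2"
      by (simp add: f_def algebra_simps)
  qed simp
  also have "\<dots> \<le> 1 / (18 * real 15 - 9) - 1 / (18 * real (15 + N) - 9)"
    using sum_inverse_squares_coprime_6[of 15 N] by simp
  also have "\<dots> \<le> 1 / 261" by simp
  also have "(\<Sum>p\<in>L. 1 / (real p)\<^sup>2) + 1 / 261 \<le> 53 / 1000"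
    by (simp add: L_def)
  finally show ?thesis by simp
qed

section \<open>Counting the elements of one cell\<close>

lemma card_congruent_le:
  fixes S :: "nat set" and m :: nat and x :: real
  assumes "m > 0" "x \<ge> 0" "\<And>n. n \<in> S \<Longrightarrow> real n \<le> x"
    and "\<And>n k. n \<in> S \<Longrightarrow> k \<in> S \<Longrightarrow> n mod m = k mod m"
  shows "real (card S) \<le> x / m + 1"
proof -
  have inj: "inj_on (\<lambda>n. n div m) S"
    using assms(4) by (intro inj_onI) (metis div_mult_mod_eq)
  have "n div m \<le> nat \<lfloor>x / m\<rfloor>" if "n \<in> S" for n
  proof -
    have "real (n div m) \<le> real n / m" by (rule of_nat_div_le_of_nat)
    also have "\<dots> \<le> x / m" using assms that by (simp add: divide_right_mono)
    finally show ?thesis by (simp add: le_nat_floor)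
  qed
  then have "(\<lambda>n. n div m) ` S \<subseteq> {..nat \<lfloor>x / m\<rfloor>}" by auto
  then have "card S \<le> card {..nat \<lfloor>x / m\<rfloor>}" using inj by (metis card_inj_on_le finite_atMost)
  then have "real (card S) \<le> real (nat \<lfloor>x / m\<rfloor>) + 1" by simp
  also have "\<dots> \<le> x / m + 1" using assms by simp
  finally show ?thesis .
qed

lemma mod_eq_mult_coprime:
  fixes n k a b :: nat
  assumes "n mod a = k mod a" "n mod b = k mod b" "coprime a b"
  shows "n mod (a * b) = k mod (a * b)"
proof -
  have "int a dvd int n - int k" "int b dvd int n - int k"
    using assms(1,2) by (metis mod_eq_dvd_iff zmod_int)+
  then have "int (a * b) dvd int n - int k"
    using assms(3) by (simp add: divides_mult)
  then show ?thesis by (metis mod_eq_dvd_iff zmod_int of_nat_eq_iff)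
qed

definition residues3 :: "nat \<Rightarrow> nat \<times> nat \<times> nat" where
  "residues3 n = (n mod 4, n mod 9, n mod 25)"

lemma residues3_eq_imp_mod_eq:
  assumes "residues3 n = residues3 k"
  shows "n mod 900 = k mod 900"
proof -
  have "coprime (4::nat) 9" "coprime (36::nat) 25" by code_simp+
  then show ?thesis
    using assms mod_eq_mult_coprime[of n 4 k 9] mod_eq_mult_coprime[of n 36 k 25]
    by (simp add: residues3_def)
qed

text \<open>For each prime \<open>p \<ge> 7\<close> the \<open>n\<close> in the cell with
  \<open>p\<^sup>2 dvd n + a\<close> form one class modulo \<open>900 * p\<^sup>2\<close>. Since
  \<open>n + a \<le> 2 * x\<close>, only primes up to \<open>sqrt (2 * x)\<close> matter, so the
  rounding errors of 1 per prime add up to at most that.\<close>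

lemma card_cell_le:
  fixes S :: "nat set" and a :: nat and x :: real
  assumes x: "x \<ge> 0" and a: "real a \<le> x" "a \<ge> 1"
    and S: "\<And>n. n \<in> S \<Longrightarrow> real n \<le> x"
    and cell: "\<And>n. n \<in> S \<Longrightarrow> residues3 n = t"
    and sq: "\<And>n. n \<in> S \<Longrightarrow> \<exists>p. prime p \<and> p \<ge> 7 \<and> p\<^sup>2 dvd n + a"
  shows "real (card S) \<le> x / 900 * (53 / 1000) + sqrt (2 * x)"
proof -
  define N where "N = nat \<lfloor>sqrt (2 * x)\<rfloor>"
  define T where "T = {p. prime p \<and> 7 \<le> p \<and> p \<le> N}"
  define B where "B p = {n \<in> S. p\<^sup>2 dvd n + a}" for p
  have "finite T" by (rule finite_subset[of _ "{..N}"]) (auto simp: T_def)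
  have "T \<subseteq> {1..N}" by (auto simp: T_def)
  then have "card T \<le> N" by (metis card_mono finite_atLeastAtMost card_atLeastAtMost diff_Suc_1)
  then have cT: "real (card T) \<le> sqrt (2 * x)" unfolding N_def using x
    by (metis le_nat_floor of_nat_le_iff of_nat_floor order.trans real_sqrt_ge_0_iff mult_nonneg_nonneg zero_le_numeral)
  have "S \<subseteq> {..nat \<lfloor>x\<rfloor>}" using S by (auto simp: le_nat_floor)
  then have finS: "finite S" by (rule finite_subset) simp
  have "S \<subseteq> (\<Union>p\<in>T. B p)"
  proof
    fix n assume n: "n \<in> S"
    from sq[OF n] obtain p where p: "prime p" "p \<ge> 7" "p\<^sup>2 dvd n + a" by blast
    then have "p\<^sup>2 \<le> n + a" using a by (intro dvd_imp_le) auto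
    then have "real (p\<^sup>2) \<le> real (n + a)" by (simp only: of_nat_le_iff)
    then have "(real p)\<^sup>2 \<le> 2 * x" using S[OF n] a by simp
    then have "real p \<le> sqrt (2 * x)" by (rule real_le_rsqrt)
    then have "p \<le> N" by (simp add: N_def le_nat_floor)
    then show "n \<in> (\<Union>p\<in>T. B p)" using n p by (auto simp: T_def B_def)
  qed
  then have "card S \<le> card (\<Union>p\<in>T. B p)"
    using finS \<open>finite T\<close> by (intro card_mono) (auto simp: B_def)
  also have "\<dots> \<le> (\<Sum>p\<in>T. card (B p))" by (rule card_UN_le[OF \<open>finite T\<close>])
  finally have "real (card S) \<le> (\<Sum>p\<in>T. real (card (B p)))" by (simp flip: of_nat_sum)
  also have "\<dots> \<le> (\<Sum>p\<in>T. x / 900 * (1 / (real p)\<^sup>2) + 1)"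
  proof (rule sum_mono)
    fix p assume "p \<in> T"
    then have p: "prime p" "p \<ge> 7" by (auto simp: T_def)
    have "coprime p 2" "coprime p 3" "coprime p 5"
      using p by (intro primes_coprime; simp)+
    then have "coprime p (2 * 2 * 3 * 3 * 5 * 5)" by (intro coprime_mult_right_iff[THEN iffD2] conjI) auto
    then have cop: "coprime 900 (p\<^sup>2)" by (simp add: coprime_commute)
    have "real (card (B p)) \<le> x / real (900 * p\<^sup>2) + 1"
    proof (rule card_congruent_le)
      fix n k assume nk: "n \<in> B p" "k \<in> B p"
      then have "n mod 900 = k mod 900"
        using cell by (intro residues3_eq_imp_mod_eq) (auto simp: B_def)
      moreover have "n mod p\<^sup>2 = k mod p\<^sup>2"
      proof -
        have "int (p\<^sup>2) dvd int (n + a)" "int (p\<^sup>2) dvd int (k + a)"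
          using nk unfolding B_def by (simp_all only: int_dvd_int_iff mem_Collect_eq)
        then have "int (p\<^sup>2) dvd int (n + a) - int (k + a)" by (rule dvd_diff)
        then have "int (p\<^sup>2) dvd int n - int k" by simp
        then show ?thesis by (metis mod_eq_dvd_iff zmod_int of_nat_eq_iff)
      qed
      ultimately show "n mod (900 * p\<^sup>2) = k mod (900 * p\<^sup>2)"
        using cop by (rule mod_eq_mult_coprime)
    qed (use p x S in \<open>auto simp: B_def\<close>)
    then show "real (card (B p)) \<le> x / 900 * (1 / (real p)\<^sup>2) + 1" by simp
  qed
  also have "\<dots> = x / 900 * (\<Sum>p\<in>T. 1 / (real p)\<^sup>2) + real (card T)"
    by (simp add: sum.distrib sum_distrib_left)
  also have "\<dots> \<le> x / 900 * (53 / 1000) + sqrt (2 * x)"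
    using x cT sum_inverse_prime_squares[OF \<open>finite T\<close>]
    by (intro add_mono mult_left_mono) (auto simp: T_def)
  finally show ?thesis .
qed

section \<open>Weights of occupied cells and fibres\<close>

text \<open>
  \<open>X\<close>, \<open>Y\<close>, \<open>Z\<close> stand for the residues modulo \<open>4\<close>, \<open>9\<close>, \<open>25\<close>, with \<open>\<alpha>\<close>, \<open>\<beta>\<close>, \<open>\<gamma>\<close> the negation maps and \<open>R\<close> the
  set of occupied cells.
\<close>

locale residue_cells =
  fixes X :: "'a set" and Y :: "'b set" and Z :: "'c set"
    and \<alpha> :: "'a \<Rightarrow> 'a" and \<beta> :: "'b \<Rightarrow> 'b" and \<gamma> :: "'c \<Rightarrow> 'c"
    and R :: "('a \<times> 'b \<times> 'c) set" and w :: real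
  assumes fin: "finite X" "finite Y" "finite Z"
    and cards: "card X = 4" "card Y = 9" "card Z = 25"
    and invol: "\<And>a. a \<in> X \<Longrightarrow> \<alpha> a \<in> X \<and> \<alpha> (\<alpha> a) = a"
      "\<And>b. b \<in> Y \<Longrightarrow> \<beta> b \<in> Y \<and> \<beta> (\<beta> b) = b"
      "\<And>c. c \<in> Z \<Longrightarrow> \<gamma> c \<in> Z \<and> \<gamma> (\<gamma> c) = c"
    and R: "R \<subseteq> X \<times> Y \<times> Z"
    and w: "0 \<le> w" "w \<le> 53 / 1000"
begin

fun compat :: "'a \<times> 'b \<times> 'c \<Rightarrow> 'a \<times> 'b \<times> 'c \<Rightarrow> bool" where
  "compat (a, b, c) (a', b', c') \<longleftrightarrow> a' = \<alpha> a \<or> b' = \<beta> b \<or> c' = \<gamma> c"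

text \<open>An upper bound for the share of a full cell, of size \<open>x / 900\<close>, that the
  set can fill up to lower order terms.\<close>

definition weight :: "'a \<times> 'b \<times> 'c \<Rightarrow> real" where
  "weight t = (if t \<notin> R then 0 else if \<forall>s\<in>R. compat t s then 1 else w)"

definition fibre_weight :: "'a \<times> 'b \<Rightarrow> real" where
  "fibre_weight q = (\<Sum>c\<in>Z. weight (fst q, snd q, c))"

definition isolated :: "'a \<times> 'b \<Rightarrow> bool" where
  "isolated q \<longleftrightarrow> (\<exists>c. (fst q, snd q, c) \<in> R) \<and>
     (\<forall>a b c. (a, b, c) \<in> R \<longrightarrow> a = \<alpha> (fst q) \<or> b = \<beta> (snd q))"

lemma weight_bounds: "0 \<le> weight t" "weight t \<le> 1"
  using w by (auto simp: weight_def)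

lemma sum_weight: "(\<Sum>t\<in>X \<times> Y \<times> Z. weight t) = (\<Sum>q\<in>X \<times> Y. fibre_weight q)"
proof -
  have "(\<Sum>t\<in>X \<times> Y \<times> Z. weight t) = (\<Sum>a\<in>X. \<Sum>b\<in>Y. \<Sum>c\<in>Z. weight (a, b, c))"
    by (simp add: sum.cartesian_product)
  also have "\<dots> = (\<Sum>a\<in>X. \<Sum>b\<in>Y. fibre_weight (a, b))"
    by (simp add: fibre_weight_def)
  also have "\<dots> = (\<Sum>q\<in>X \<times> Y. fibre_weight q)"
    by (simp add: sum.cartesian_product)
  finally show ?thesis .
qed

lemma fibre_weight_le_25: "fibre_weight q \<le> 25"
proof -
  have "fibre_weight q \<le> (\<Sum>c\<in>Z. 1)"
    unfolding fibre_weight_def by (intro sum_mono weight_bounds)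
  then show ?thesis using cards by simp
qed

lemma fibre_weight_eq_0: "\<nexists>c. (fst q, snd q, c) \<in> R \<Longrightarrow> fibre_weight q = 0"
  by (simp add: fibre_weight_def weight_def)

lemma fibre_weight_le_of_support:
  assumes "\<And>c. c \<in> Z \<Longrightarrow> c \<noteq> d \<Longrightarrow> weight (fst q, snd q, c) \<le> u"
    and "weight (fst q, snd q, d) \<le> v" "0 \<le> u" "u \<le> v"
  shows "fibre_weight q \<le> v + 24 * u"
proof -
  have "fibre_weight q \<le> (\<Sum>c\<in>Z. u + (if c = d then v - u else 0))"
    unfolding fibre_weight_def by (intro sum_mono) (use assms in auto)
  also have "\<dots> \<le> 25 * u + (v - u)"
    using fin cards assms by (simp add: sum.distrib sum.delta)
  finally show ?thesis by simp
qed

text \<open>Some occupied \<open>(a, b, c)\<close> cancels the fibre neither in the first nor in the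
  second coordinate. It is then compatible only with the cell of third coordinate
  \<open>\<gamma> c\<close>, and all others weigh at most \<open>w\<close>.\<close>

lemma fibre_weight_not_isolated:
  assumes "\<not> isolated q"
  shows "fibre_weight q \<le> 25 / 11"
proof (cases "\<exists>c. (fst q, snd q, c) \<in> R")
  case True
  then obtain a b c where s: "(a, b, c) \<in> R" "a \<noteq> \<alpha> (fst q)" "b \<noteq> \<beta> (snd q)"
    using assms by (auto simp: isolated_def)
  then have c: "c \<in> Z" using R by auto
  have "fibre_weight q \<le> 1 + 24 * w"
  proof (rule fibre_weight_le_of_support)
    fix d assume d: "d \<in> Z" "d \<noteq> \<gamma> c"
    then have "c \<noteq> \<gamma> d" using invol by metis
    then have "\<not> compat (fst q, snd q, d) (a, b, c)" using s by simp
    then show "weight (fst q, snd q, d) \<le> w" using s w unfolding weight_def by auto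
  qed (use w weight_bounds in auto)
  also have "\<dots> \<le> 25 / 11" using w by simp
  finally show ?thesis .
qed (simp add: fibre_weight_eq_0)

text \<open>Occupied fibres lie in the crosses of both isolated fibres. If these share a coordinate,
  the crosses meet in a single line, whose coordinate is its own negative because the isolated
  fibres are occupied; this is excluded. Otherwise the crosses meet in two fibres of weight at most
  25 each.\<close>

lemma two_isolated:
  assumes i: "isolated i" "isolated j" "i \<noteq> j"
    and X: "\<nexists>a. \<alpha> a = a \<and> (\<forall>t\<in>R. fst t = a)"
    and Y: "\<nexists>b. \<beta> b = b \<and> (\<forall>t\<in>R. fst (snd t) = b)"
  shows "(\<Sum>q\<in>X \<times> Y. fibre_weight q) \<le> 50"
proof -
  obtain a b a' b' where ij: "i = (a, b)" "j = (a', b')" by (cases i, cases j)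
  from i ij obtain c c' where R': "(a, b, c) \<in> R" "(a', b', c') \<in> R" by (auto simp: isolated_def)
  then have mem: "a \<in> X" "a' \<in> X" "b \<in> Y" "b' \<in> Y" using R by auto
  have N: "(x = \<alpha> a \<or> y = \<beta> b) \<and> (x = \<alpha> a' \<or> y = \<beta> b')" if "(x, y, z) \<in> R" for x y z
    using i ij that unfolding isolated_def by (metis fst_conv snd_conv)
  have "a \<noteq> a'"
  proof
    assume "a = a'"
    then have "\<beta> b \<noteq> \<beta> b'" using i ij mem invol(2) by metis
    then have "x = \<alpha> a" if "(x, y, z) \<in> R" for x y z using N[OF that] \<open>a = a'\<close> by auto
    moreover from this R' have "\<alpha> a = a" by metis
    ultimately show False using X by fastforce
  qed
  moreover have "b \<noteq> b'"
  proof
    assume "b = b'"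
    then have "\<alpha> a \<noteq> \<alpha> a'" using i ij mem invol(1) by metis
    then have "y = \<beta> b" if "(x, y, z) \<in> R" for x y z using N[OF that] \<open>b = b'\<close> by auto
    moreover from this R' have "\<beta> b = b" by metis
    ultimately show False using Y by fastforce
  qed
  ultimately have ne: "\<alpha> a \<noteq> \<alpha> a'" "\<beta> b \<noteq> \<beta> b'" using mem invol by metis+
  let ?D = "{(\<alpha> a, \<beta> b'), (\<alpha> a', \<beta> b)}"
  have "fibre_weight q = 0" if "q \<notin> ?D" for q
  proof (rule fibre_weight_eq_0)
    show "\<nexists>c. (fst q, snd q, c) \<in> R" using N that ne by (cases q) fastforce
  qed
  then have "(\<Sum>q\<in>X \<times> Y. fibre_weight q) = (\<Sum>q\<in>?D. fibre_weight q)"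
    using fin mem invol by (intro sum.mono_neutral_right) auto
  also have "\<dots> \<le> 25 + 25" using ne fibre_weight_le_25[of "(\<alpha> a, \<beta> b')"] fibre_weight_le_25[of "(\<alpha> a', \<beta> b)"] by simp
  finally show ?thesis by simp
qed

text \<open>The fibres whose sum with the fibre of \<open>(a, b)\<close> vanishes modulo \<open>4\<close> or modulo \<open>9\<close>.\<close>

definition cross :: "'a \<Rightarrow> 'b \<Rightarrow> ('a \<times> 'b) set" where
  "cross a b = {\<alpha> a} \<times> Y \<union> (X - {\<alpha> a}) \<times> {\<beta> b}"

lemma card_cross:
  assumes "a \<in> X"
  shows "finite (cross a b)" "card (cross a b) = 12"
proof -
  show "finite (cross a b)" using fin by (simp add: cross_def)
  have "card (cross a b) = card ({\<alpha> a} \<times> Y) + card ((X - {\<alpha> a}) \<times> {\<beta> b})"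
    unfolding cross_def by (rule card_Un_disjoint) (use fin in auto)
  then show "card (cross a b) = 12"
    using fin cards assms invol by (simp add: card_cartesian_product)
qed

lemma one_isolated:
  assumes i: "isolated i" and uniq: "\<And>j. isolated j \<Longrightarrow> j = i"
  shows "(\<Sum>q\<in>X \<times> Y. fibre_weight q) \<le> 50"
proof -
  obtain a b where ab: "i = (a, b)" by (cases i)
  from i ab obtain c where R': "(a, b, c) \<in> R" by (auto simp: isolated_def)
  then have mem: "a \<in> X" "b \<in> Y" using R by auto
  have N: "x = \<alpha> a \<or> y = \<beta> b" if "(x, y, z) \<in> R" for x y z
    using i ab that by (auto simp: isolated_def)
  have D: "cross a b \<subseteq> X \<times> Y" using mem invol by (auto simp: cross_def)
  \<comment> \<open>An isolated fibre is occupied, so the condition \<open>N\<close> applies to the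
    fibre itself.\<close>
  have "i \<in> cross a b" using N[OF R'] mem ab by (auto simp: cross_def)
  have "fibre_weight q = 0" if "q \<in> X \<times> Y - cross a b" for q
  proof (rule fibre_weight_eq_0)
    show "\<nexists>c. (fst q, snd q, c) \<in> R" using N that by (cases q) (auto simp: cross_def)
  qed
  then have "(\<Sum>q\<in>X \<times> Y. fibre_weight q) = (\<Sum>q\<in>cross a b. fibre_weight q)"
    using fin D by (intro sum.mono_neutral_right) auto
  also have "\<dots> = fibre_weight i + (\<Sum>q\<in>cross a b - {i}. fibre_weight q)"
    using \<open>i \<in> cross a b\<close> card_cross mem by (intro sum.remove) auto
  also have "\<dots> \<le> 25 + (\<Sum>q\<in>cross a b - {i}. 25 / 11)"
    by (intro add_mono sum_mono fibre_weight_le_25 fibre_weight_not_isolated) (use uniq in auto)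
  also have "\<dots> = 50" using \<open>i \<in> cross a b\<close> card_cross mem by simp
  finally show ?thesis .
qed

text \<open>
  If some cell \<open>(a, b, c)\<close> has weight \<open>1\<close>, then in the 24 fibres outside \<open>cross a b\<close> only the residue \<open>\<gamma> c\<close>
  can occur modulo \<open>25\<close>. An occupied cell whose last residue is not \<open>c\<close> lowers the weight to \<open>w\<close> in at least
  14 of them.
\<close>

lemma no_isolated:
  assumes no: "\<And>q. \<not> isolated q"
  shows "(\<Sum>q\<in>X \<times> Y. fibre_weight q) \<le> 50"
proof (cases "\<exists>t\<in>R. \<forall>s\<in>R. compat t s")
  case False
  then have "weight t \<le> w" for t using w by (auto simp: weight_def)
  then have "(\<Sum>t\<in>X \<times> Y \<times> Z. weight t) \<le> (\<Sum>t\<in>X \<times> Y \<times> Z. w)" by (intro sum_mono)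
  \<comment> \<open>Here \<open>900 * 53 / 1000 = 47.7\<close>.\<close>
  also have "\<dots> \<le> 50" using w cards by (simp add: card_cartesian_product)
  finally show ?thesis by (simp add: sum_weight)
next
  case True
  then obtain a b c where t: "(a, b, c) \<in> R" and "\<forall>s\<in>R. compat (a, b, c) s"
    by (metis prod_cases3)
  then have N: "x = \<alpha> a \<or> y = \<beta> b \<or> z = \<gamma> c" if "(x, y, z) \<in> R" for x y z
    using that compat.simps by blast
  have mem: "a \<in> X" "b \<in> Y" "c \<in> Z" using R t by auto
  show ?thesis
  proof (cases "\<forall>x y z. (x, y, z) \<in> R \<longrightarrow> z = c")
    case True
    \<comment> \<open>Each fibre has at most one occupied cell, so the total is at most 36.\<close>
    have "fibre_weight q \<le> 1 + 24 * 0" for q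
      by (rule fibre_weight_le_of_support[where d = c])
        (use True weight_bounds in \<open>auto simp: weight_def\<close>)
    then have "(\<Sum>q\<in>X \<times> Y. fibre_weight q) \<le> (\<Sum>q\<in>X \<times> Y. 1)" by (intro sum_mono) simp
    then show ?thesis using cards by (simp add: card_cartesian_product)
  next
    case False
    then obtain x y z where r: "(x, y, z) \<in> R" "z \<noteq> c" by blast
    define D where "D = X \<times> Y - cross a b"
    \<comment> \<open>In these fibres the only possible cell, with third coordinate
      \<open>\<gamma> c\<close>, is incompatible with \<open>(x, y, z)\<close>, as \<open>z\<close>
      differs from \<open>c = \<gamma> (\<gamma> c)\<close>.\<close>
    define Q where "Q = (X - {\<alpha> a, \<alpha> x}) \<times> (Y - {\<beta> b, \<beta> y})"
    have Q: "Q \<subseteq> D" by (auto simp: Q_def D_def cross_def)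
    have sub: "cross a b \<subseteq> X \<times> Y" using mem invol by (auto simp: cross_def)
    have "finite D" using fin by (simp add: D_def)
    have "card D = 24" unfolding D_def using sub fin cards card_cross mem
      by (subst card_Diff_subset) (auto simp: card_cartesian_product)
    have "card (X - {\<alpha> a, \<alpha> x}) \<ge> 2" "card (Y - {\<beta> b, \<beta> y}) \<ge> 7"
      using diff_card_le_card_Diff[of "{\<alpha> a, \<alpha> x}" X] diff_card_le_card_Diff[of "{\<beta> b, \<beta> y}" Y]
        cards card_insert_le_m1[of 2 "{\<alpha> x}" "\<alpha> a"] card_insert_le_m1[of 2 "{\<beta> y}" "\<beta> b"] by auto
    then have cQ: "card Q \<ge> 14" using mult_mono[of 2 _ 7] by (fastforce simp: Q_def card_cartesian_product)
    have le1: "fibre_weight q \<le> 1" "q \<in> Q \<Longrightarrow> fibre_weight q \<le> w" if "q \<in> D" for q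
    proof -
      have q: "fst q \<in> X" "snd q \<in> Y" "fst q \<noteq> \<alpha> a" "snd q \<noteq> \<beta> b"
        using that by (auto simp: D_def cross_def)
      have 0: "weight (fst q, snd q, d) \<le> 0" if "d \<noteq> \<gamma> c" for d
        using N q that by (auto simp: weight_def)
      have "fibre_weight q \<le> 1 + 24 * 0"
        by (rule fibre_weight_le_of_support[OF 0]) (auto simp: weight_bounds)
      then show "fibre_weight q \<le> 1" by simp
      assume "q \<in> Q"
      then have "x \<noteq> \<alpha> (fst q)" "y \<noteq> \<beta> (snd q)" using q invol by (auto simp: Q_def)
      moreover have "z \<noteq> \<gamma> (\<gamma> c)" using r mem invol by auto
      ultimately have "\<not> compat (fst q, snd q, \<gamma> c) (x, y, z)" by simp
      then have "weight (fst q, snd q, \<gamma> c) \<le> w" using r w unfolding weight_def by auto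
      then have "fibre_weight q \<le> w + 24 * 0"
        by (intro fibre_weight_le_of_support[OF 0]) (use w in auto)
      then show "fibre_weight q \<le> w" by simp
    qed
    have "(\<Sum>q\<in>X \<times> Y. fibre_weight q) = (\<Sum>q\<in>D. fibre_weight q) + (\<Sum>q\<in>cross a b. fibre_weight q)"
      unfolding D_def using sub fin by (intro sum.subset_diff) auto
    also have "(\<Sum>q\<in>cross a b. fibre_weight q) \<le> (\<Sum>q\<in>cross a b. 25 / 11)"
      by (intro sum_mono fibre_weight_not_isolated no)
    also have "\<dots> = 12 * (25 / 11)" using card_cross mem by simp
    also have "(\<Sum>q\<in>D. fibre_weight q) = (\<Sum>q\<in>D - Q. fibre_weight q) + (\<Sum>q\<in>Q. fibre_weight q)"
      using Q \<open>finite D\<close> by (intro sum.subset_diff)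
    also have "(\<Sum>q\<in>Q. fibre_weight q) \<le> (\<Sum>q\<in>Q. w)" using le1 Q by (intro sum_mono) auto
    also have "\<dots> = w * card Q" by simp
    also have "w * card Q \<le> 53 / 1000 * 24"
      using w card_mono[OF \<open>finite D\<close> Q] \<open>card D = 24\<close> by (intro mult_mono) auto
    also have "(\<Sum>q\<in>D - Q. fibre_weight q) \<le> (\<Sum>q\<in>D - Q. 1)" using le1 by (intro sum_mono) auto
    also have "\<dots> \<le> 10"
      using cQ Q \<open>card D = 24\<close> \<open>finite D\<close> finite_subset[OF Q] by (simp add: card_Diff_subset)
    \<comment> \<open>The total is at most \<open>10 + 1.272 + 300 / 11 < 39\<close>.\<close>
    finally show ?thesis by simp
  qed
qed

theorem sum_weight_le:
  assumes "\<nexists>a. \<alpha> a = a \<and> (\<forall>t\<in>R. fst t = a)"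
    and "\<nexists>b. \<beta> b = b \<and> (\<forall>t\<in>R. fst (snd t) = b)"
  shows "(\<Sum>t\<in>X \<times> Y \<times> Z. weight t) \<le> 50"
  unfolding sum_weight using two_isolated[OF _ _ _ assms] one_isolated no_isolated by metis

end

section \<open>Negation of residues and the passage from weights to integers\<close>

text \<open>The right side is the residue of \<open>- n\<close> written in natural numbers; the
  outer \<open>mod\<close> turns \<open>m\<close> into 0 when \<open>m\<close> divides
  \<open>n\<close>.\<close>

lemma dvd_add_iff_eq_neg_mod:
  fixes m n k :: nat
  assumes "m > 0"
  shows "m dvd n + k \<longleftrightarrow> k mod m = (m - n mod m) mod m"
proof
  assume "m dvd n + k"
  then have "m dvd n mod m + k mod m" by (simp add: dvd_eq_mod_eq_0 mod_add_eq)
  then obtain q where q: "n mod m + k mod m = m * q" by blast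
  moreover have lt: "n mod m < m" "k mod m < m" using assms by auto
  ultimately have "m * q < m * 2" by linarith
  then have "q = 0 \<or> q = 1" by auto
  then show "k mod m = (m - n mod m) mod m"
  proof
    assume "q = 0"
    then show ?thesis using q by simp
  next
    assume "q = 1"
    then have "k mod m = m - n mod m" using q by simp
    then show ?thesis by (metis mod_mod_trivial)
  qed
next
  assume "k mod m = (m - n mod m) mod m"
  then have "(n + k) mod m = (n mod m + (m - n mod m)) mod m" by (metis mod_add_eq mod_mod_trivial)
  also have "n mod m + (m - n mod m) = m" using assms by (simp add: less_imp_le)
  finally show "m dvd n + k" by (simp add: dvd_eq_mod_eq_0)
qed

lemma neg_mod_involution:
  fixes a m :: nat
  assumes "a < m"
  shows "(m - (m - a) mod m) mod m = a"
  using assms by (cases "a = 0") auto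

text \<open>This is the source of the three exceptional sets: the self-negative residues are 0 and 2
  modulo 4, but only 0 modulo 9.\<close>

lemma neg_mod_fixpoint:
  fixes a m :: nat
  assumes "m > 0" "(m - a) mod m = a"
  shows "a = 0 \<or> 2 * a = m"
proof (cases "a = 0")
  case False
  have "a < m" using assms mod_less_divisor by metis
  then have "m - a = a" using assms False by simp
  then show ?thesis using \<open>a < m\<close> by linarith
qed simp

lemma not_squarefree_imp_prime_square_dvd:
  fixes n :: nat
  assumes "\<not> squarefree n" "n > 0"
  shows "\<exists>p. prime p \<and> p\<^sup>2 dvd n"
proof -
  from assms obtain d where d: "d\<^sup>2 dvd n" "\<not> d dvd 1" by (auto simp: squarefree_def)
  then obtain p where "prime p" "p dvd d" by (metis prime_factor_nat dvd_refl)
  then show ?thesis using d by (meson dvd_power_same dvd_trans)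
qed

text \<open>Total weight 50 gives the main term \<open>50 * x / 900 = x / 18\<close>, and each of
  the 900 cells contributes an error of at most \<open>sqrt (2 * x) + 1\<close>.\<close>

lemma card_le_if_not_special:
  fixes x :: real and A :: "nat set"
  assumes x: "x \<ge> 0" and A: "A \<subseteq> {n. 1 \<le> n \<and> real n \<le> x}"
    and sums: "\<And>a b. a \<in> A \<Longrightarrow> b \<in> A \<Longrightarrow> \<not> squarefree (a + b)"
    and not_special: "\<not> A \<subseteq> {n. 4 dvd n}" "\<not> A \<subseteq> {n. 9 dvd n}" "\<not> A \<subseteq> {n. n mod 4 = 2}"
  shows "real (card A) \<le> x / 18 + 900 * (sqrt (2 * x) + 1)"
proof -
  let ?T = "{..<4::nat} \<times> {..<9::nat} \<times> {..<25::nat}"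
  interpret residue_cells "{..<4::nat}" "{..<9::nat}" "{..<25::nat}"
    "\<lambda>a. (4 - a) mod 4" "\<lambda>b. (9 - b) mod 9" "\<lambda>c. (25 - c) mod 25" "residues3 ` A" "53 / 1000"
    using neg_mod_involution[of _ "4::nat"] neg_mod_involution[of _ "9::nat"]
      neg_mod_involution[of _ "25::nat"]
    by unfold_locales (auto simp: residues3_def)
  have "A \<subseteq> {..nat \<lfloor>x\<rfloor>}" using A by (auto simp: le_nat_floor)
  then have finA: "finite A" by (rule finite_subset) simp
  define cell where "cell t = {n \<in> A. residues3 n = t}" for t
  have cell_le: "real (card (cell t)) \<le> x / 900 * weight t + (sqrt (2 * x) + 1)" for t
  proof -
    consider "t \<notin> residues3 ` A" | "t \<in> residues3 ` A" "\<forall>s\<in>residues3 ` A. compat t s"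
      | a where "t \<in> residues3 ` A" "a \<in> A" "\<not> compat t (residues3 a)" by blast
    then show ?thesis
    proof cases
      case 1
      then have "cell t = {}" by (auto simp: cell_def)
      then show ?thesis using 1 x by (simp add: weight_def)
    next
      case 2
      have "real (card (cell t)) \<le> x / real 900 + 1"
        by (rule card_congruent_le)
          (use x A in \<open>auto simp: cell_def intro!: residues3_eq_imp_mod_eq\<close>)
      moreover have weight: "weight t = 1" using 2 unfolding weight_def by auto
      moreover have "sqrt (2 * x) \<ge> 0" using x by simp
      ultimately show ?thesis unfolding weight by linarith
    next
      case 3
      have "real (card (cell t)) \<le> x / 900 * (53 / 1000) + sqrt (2 * x)"
      proof (rule card_cell_le)
        fix n assume n: "n \<in> cell t"
        then have nA: "n \<in> A" and t: "t = residues3 n" by (auto simp: cell_def)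
        \<comment> \<open>Compatibility depends on residues only, so the same \<open>a\<close>
          serves for every \<open>n\<close> in the cell.\<close>
        have nd: "\<not> 2\<^sup>2 dvd n + a" "\<not> 3\<^sup>2 dvd n + a" "\<not> 5\<^sup>2 dvd n + a"
          using 3(3) t by (simp_all add: residues3_def dvd_add_iff_eq_neg_mod)
        obtain p where p: "prime p" "p\<^sup>2 dvd n + a"
          using not_squarefree_imp_prime_square_dvd[OF sums[OF nA 3(2)]] nA A by fastforce
        then have "p \<noteq> 2" "p \<noteq> 3" "p \<noteq> 5" using nd by auto
        moreover have "p \<noteq> 4" "p \<noteq> 6" using p(1) by auto
        moreover have "p \<ge> 2" using p(1) by (rule prime_ge_2_nat)
        ultimately have "p \<ge> 7" by linarith
        then show "\<exists>p. prime p \<and> p \<ge> 7 \<and> p\<^sup>2 dvd n + a" using p by blast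
      qed (use 3 x A in \<open>auto simp: cell_def\<close>)
      moreover have weight: "weight t = 53 / 1000" using 3 by (auto simp: weight_def)
      ultimately show ?thesis unfolding weight by linarith
    qed
  qed
  have "(\<Sum>t\<in>?T. weight t) \<le> 50"
  proof (rule sum_weight_le)
    show "\<nexists>a. (4 - a) mod 4 = a \<and> (\<forall>t\<in>residues3 ` A. fst t = a)"
    proof
      assume "\<exists>a. (4 - a) mod 4 = a \<and> (\<forall>t\<in>residues3 ` A. fst t = a)"
      then obtain a :: nat where a: "(4 - a) mod 4 = a" "\<forall>n\<in>A. n mod 4 = a" by (auto simp: residues3_def)
      have "a = 0 \<or> a = 2" using neg_mod_fixpoint[OF _ a(1)] by auto
      then show False using a(2) not_special by auto
    qed
    show "\<nexists>b. (9 - b) mod 9 = b \<and> (\<forall>t\<in>residues3 ` A. fst (snd t) = b)"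
    proof
      assume "\<exists>b. (9 - b) mod 9 = b \<and> (\<forall>t\<in>residues3 ` A. fst (snd t) = b)"
      then obtain b :: nat where b: "(9 - b) mod 9 = b" "\<forall>n\<in>A. n mod 9 = b" by (auto simp: residues3_def)
      have "b = 0" using neg_mod_fixpoint[OF _ b(1)] by presburger
      then show False using b(2) not_special by auto
    qed
  qed
  then have le50: "x / 900 * (\<Sum>t\<in>?T. weight t) \<le> x / 900 * 50"
    using x by (intro mult_left_mono) auto
  have "card A = (\<Sum>t\<in>?T. card (cell t))"
    using sum.group[of A ?T residues3 "\<lambda>_. 1::nat"] finA R by (simp add: cell_def)
  then have "real (card A) = (\<Sum>t\<in>?T. real (card (cell t)))" by simp
  also have "\<dots> \<le> (\<Sum>t\<in>?T. x / 900 * weight t + (sqrt (2 * x) + 1))"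
    by (intro sum_mono cell_le)
  also have "\<dots> = x / 900 * (\<Sum>t\<in>?T. weight t) + 900 * (sqrt (2 * x) + 1)"
    by (simp only: sum.distrib sum_distrib_left) (simp add: card_cartesian_product)
  finally show ?thesis using le50 by simp
qed

theorem theorem1:
  fixes \<epsilon> :: real
  assumes "\<epsilon> > 0"
  shows "\<exists>x0::real. \<forall>x::real. x > x0 \<longrightarrow>
           (\<forall>A :: nat set.
              A \<subseteq> {n. 1 \<le> n \<and> real n \<le> x}
              \<longrightarrow> (\<forall>a\<in>A. \<forall>b\<in>A. \<not> squarefree (a + b))
              \<longrightarrow> real (card A) > (1/18 + \<epsilon>) * x
              \<longrightarrow> (A \<subseteq> {n. 4 dvd n} \<or> A \<subseteq> {n. 9 dvd n}
                   \<or> A \<subseteq> {n. n mod 4 = 2}))"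
proof (intro exI allI impI)
  fix x :: real and A :: "nat set"
  \<comment> \<open>For \<open>x \<ge> 1\<close> the error is at most
    \<open>900 * (2 * sqrt x + sqrt x) = 2700 * sqrt x\<close>, and this threshold makes that at
    most \<open>\<epsilon> * x\<close>.\<close>
  assume x: "x > max 1 ((2700 / \<epsilon>)\<^sup>2)"
    and A: "A \<subseteq> {n. 1 \<le> n \<and> real n \<le> x}"
    and sums: "\<forall>a\<in>A. \<forall>b\<in>A. \<not> squarefree (a + b)"
    and large: "real (card A) > (1/18 + \<epsilon>) * x"
  have "sqrt x \<ge> 2700 / \<epsilon>" using x by (intro real_le_rsqrt) auto
  then have "2700 \<le> \<epsilon> * sqrt x" using assms by (simp add: divide_le_eq mult.commute)
  then have "2700 * sqrt x \<le> (\<epsilon> * sqrt x) * sqrt x" using x by (intro mult_right_mono) auto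
  also have "\<dots> = \<epsilon> * x" using x by simp
  finally have le: "2700 * sqrt x \<le> \<epsilon> * x" .
  have "sqrt (2 * x) \<le> sqrt (2\<^sup>2 * x)" using x by (intro real_sqrt_le_mono) auto
  then have "sqrt (2 * x) \<le> 2 * sqrt x" by (simp add: real_sqrt_mult)
  moreover have "sqrt x \<ge> 1" using x by simp
  ultimately have "900 * (sqrt (2 * x) + 1) \<le> \<epsilon> * x" using le by argo
  then have "\<not> real (card A) \<le> x / 18 + 900 * (sqrt (2 * x) + 1)"
    using large by (simp add: algebra_simps)
  then show "A \<subseteq> {n. 4 dvd n} \<or> A \<subseteq> {n. 9 dvd n} \<or> A \<subseteq> {n. n mod 4 = 2}"
    using card_le_if_not_special[of x A] x A sums by auto
qed

end
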